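(* Let $R$ and $S$ be compact metric spaces. Assume there exists a Lipschitz embedding $F$ of the unit ball $B_{C(R)}$ of $C(R)$ into $C(S)$ such that $$\forall f,g \in B_{C(R)}\quad \frac{15}{16}\,\|f-g\|\le \|F(f)-F(g)\| \le \|f-g\|.$$ Then $C(R)$ is linearly isometric to a subspace of $C(S)$.
   Context: Banach spaces are real. For a compact metric space $R$, $C(R)$ is the Banach space of continuous real-valued functions on $R$ with the supremum norm, and $B_{C(R)}$ is its closed unit ball. The map $F$ is not assumed linear. "Linearly isometric to a subspace of $C(S)$" means that there is a linear norm-preserving map into $C(S)$. *)

theory Defs
  imports "HOL-Analysis.Analysis"
begin

end

theory Submission
  imports Defs
begin

text \<open>
  The idea is a non-linear version of Holsztynski's argument: from \<open>F\<close> one reads off a closed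
  subset \<open>A\<close> of \<open>S\<close> and a continuous surjection \<open>\<phi>\<close> of \<open>A\<close> onto \<open>R\<close>.  Then \<open>f \<mapsto> f \<circ> \<phi>\<close> is a linear
  isometry into the continuous functions on \<open>A\<close>, and a linear extension operator of norm one from
  \<open>A\<close> to \<open>S\<close> finishes the proof (\<open>linear_isometry_of_continuous_surjection\<close>).

  To find \<open>\<phi>\<close>, let \<open>c\<close> be the lower Lipschitz constant, fix \<open>r\<close> in \<open>R\<close> and take a narrow bump \<open>f\<close> of
  height one at \<open>r\<close>.  Since \<open>f\<close> and \<open>- f\<close> have distance two, there is a point \<open>s\<close> at which \<open>F f\<close> and
  \<open>F (- f)\<close> differ by at least \<open>2 * c\<close>.  Such a point depends on \<open>f\<close>; what survives when the bump
  gets narrower is a property of \<open>r\<close> alone, and it is obtained by looking only at functions of norm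
  at most one half.  A function \<open>h\<close> of this kind has distance at most one half from \<open>f\<close> away from
  \<open>r\<close>, and up to a small error at most \<open>1 - h r\<close> near \<open>r\<close>; as \<open>1 - h r\<close> is at least one half, it
  bounds the whole distance.  The upper Lipschitz estimate therefore carries the large oscillation
  from the bumps over to all such functions: after a limit, some \<open>s\<close> and some sign \<open>\<sigma>\<close> satisfy
  \<open>2 * c - 2 + h r - k r \<le> \<sigma> * (F h s - F k s)\<close> for all \<open>h\<close> and \<open>k\<close> of norm at most one half
  (\<open>peak_relation_total\<close>).

  This inequality is a closed condition on \<open>(s, r)\<close>.  If \<open>h r = 1/2\<close> and \<open>k = - h\<close>, its left-hand side
  is \<open>2 * c - 1\<close>, which is positive as soon as \<open>c > 1/2\<close>; so at \<open>s\<close> the sign of \<open>F h s - F (- h) s\<close> is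
  prescribed by \<open>r\<close>.  Two different points \<open>r\<close>, \<open>r'\<close> would prescribe contradictory signs for a suitable
  \<open>h\<close>, so \<open>s\<close> determines \<open>r\<close> (\<open>peak_relation_functional\<close>).  A closed relation between compact spaces
  in which \<open>s\<close> determines \<open>r\<close> and every \<open>r\<close> occurs is a continuous surjection defined on a compact set
  of points \<open>s\<close>.
\<close>

section \<open>A linear extension operator of norm one\<close>

text \<open>
  Norm bounds, summability and continuity at the boundary of the extension operator are all
  instances of one fact: a weighted mean lies near \<open>b\<close> if the entries with non-zero weight do.
\<close>

lemma weighted_mean_near:
  fixes w c :: "nat \<Rightarrow> real"
  assumes w: "summable w" "\<And>n. 0 \<le> w n" "0 < suminf w"
    and near: "\<And>n. w n \<noteq> 0 \<Longrightarrow> \<bar>c n - b\<bar> \<le> e"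
  shows "summable (\<lambda>n. w n * c n)"
    and "\<bar>(\<Sum>n. w n * c n) / suminf w - b\<bar> \<le> e"
proof -
  have bound: "norm (w n * (c n - b)) \<le> w n * e" for n
    using near[of n] w(2)[of n] by (cases "w n = 0") (auto simp: abs_mult intro: mult_left_mono)
  have sume: "summable (\<lambda>n. w n * e)"
    using w(1) by (rule summable_mult2)
  have sumd: "summable (\<lambda>n. w n * (c n - b))"
    by (rule summable_comparison_test'[OF sume bound])
  have sumb: "summable (\<lambda>n. w n * b)"
    using w(1) by (rule summable_mult2)
  have eq: "w n * c n = w n * (c n - b) + w n * b" for n
    by (simp add: algebra_simps)
  show "summable (\<lambda>n. w n * c n)"
    unfolding eq by (intro summable_add sumd sumb)
  have "(\<Sum>n. w n * c n) = (\<Sum>n. w n * (c n - b)) + suminf w * b"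
    unfolding eq by (simp only: suminf_add[OF sumd sumb, symmetric] suminf_mult2[OF w(1), symmetric])
  then have "(\<Sum>n. w n * c n) / suminf w - b = (\<Sum>n. w n * (c n - b)) / suminf w"
    using w(3) by (simp add: field_simps)
  moreover have "\<bar>\<Sum>n. w n * (c n - b)\<bar> \<le> (\<Sum>n. w n * e)"
    using norm_suminf_le[OF bound sume] by simp
  moreover have "(\<Sum>n. w n * e) = suminf w * e"
    by (rule suminf_mult2[OF w(1), symmetric])
  ultimately show "\<bar>(\<Sum>n. w n * c n) / suminf w - b\<bar> \<le> e"
    using w(3) by (simp add: abs_divide pos_divide_le_eq mult.commute)
qed

lemma compact_dense_sequence:
  fixes A :: "'s::metric_space set"
  assumes "compact A" "A \<noteq> {}"
  shows "\<exists>a :: nat \<Rightarrow> 's. range a \<subseteq> A \<and> (\<forall>y\<in>A. \<forall>e>0. \<exists>n. dist (a n) y < e)"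
proof -
  have "\<exists>k. finite k \<and> k \<subseteq> A \<and> A \<subseteq> (\<Union>x\<in>k. ball x (inverse (Suc m)))" for m
    using seq_compact_imp_totally_bounded[of A] assms(1)
    by (simp add: compact_eq_seq_compact_metric)
  then obtain k where k: "\<And>m. finite (k m)" "\<And>m. k m \<subseteq> A"
    "\<And>m. A \<subseteq> (\<Union>x\<in>k m. ball x (inverse (Suc m)))"
    by metis
  let ?D = "\<Union>m. k m"
  have "countable ?D"
    using k(1) by (simp add: countable_finite)
  moreover have "?D \<noteq> {}"
    using k(3)[of 0] assms(2) by auto
  ultimately have ran: "range (from_nat_into ?D) = ?D"
    by (rule range_from_nat_into[rotated])
  have "\<exists>n. dist (from_nat_into ?D n) y < e" if "y \<in> A" "0 < e" for y e
  proof -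
    obtain m where m: "inverse (real (Suc m)) < e"
      using reals_Archimedean[OF \<open>0 < e\<close>] by auto
    obtain x where x: "x \<in> k m" "dist x y < inverse (real (Suc m))"
      using k(3)[of m] \<open>y \<in> A\<close> by auto
    have "x \<in> range (from_nat_into ?D)"
      unfolding ran using x(1) by auto
    then obtain n where "x = from_nat_into ?D n"
      by blast
    then show ?thesis
      using x(2) m by (intro exI[of _ n]) simp
  qed
  moreover have "range (from_nat_into ?D) \<subseteq> A"
    using ran k(2) by auto
  ultimately show ?thesis
    by (intro exI[of _ "from_nat_into ?D"]) simp
qed

text \<open>
  At a point \<open>x\<close> outside \<open>A\<close> only those points \<open>a n\<close> get a positive weight that are less than twice as
  far from \<open>x\<close> as \<open>A\<close> is.  Since \<open>a\<close> is dense in \<open>A\<close>, there is at least one, and as \<open>x\<close> approaches a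
  point of \<open>A\<close> all of them approach it too.  The factor \<open>(1/2)^n\<close> makes the total weight a
  uniformly convergent series of continuous functions.
\<close>

definition extension_weight :: "'s::metric_space set \<Rightarrow> (nat \<Rightarrow> 's) \<Rightarrow> 's \<Rightarrow> nat \<Rightarrow> real" where
  "extension_weight A a x n = (1/2)^n * max 0 (2 - dist x (a n) / infdist x A)"

definition extend_from ::
  "'s::metric_space set \<Rightarrow> (nat \<Rightarrow> 's) \<Rightarrow> ('s \<Rightarrow> real) \<Rightarrow> 's \<Rightarrow> real" where
  "extend_from A a f x =
     (if x \<in> A then f x
      else (\<Sum>n. extension_weight A a x n * f (a n)) / (\<Sum>n. extension_weight A a x n))"

locale dense_sequence =
  fixes A :: "'s::metric_space set" and a :: "nat \<Rightarrow> 's"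
  assumes closed: "closed A"
    and in_A: "\<And>n. a n \<in> A"
    and dense: "\<And>y e. y \<in> A \<Longrightarrow> 0 < e \<Longrightarrow> \<exists>n. dist (a n) y < e"
begin

abbreviation "w \<equiv> extension_weight A a"

lemma A_nonempty: "A \<noteq> {}"
  using in_A by auto

lemma infdist_pos: "x \<notin> A \<Longrightarrow> 0 < infdist x A"
  using in_closed_iff_infdist_zero[OF closed A_nonempty] infdist_nonneg[of x A] by force

lemma weight_nonneg: "0 \<le> w x n"
  by (simp add: extension_weight_def)

lemma weight_bound: "w x n \<le> 2 * (1/2)^n"
proof -
  have "max 0 (2 - dist x (a n) / infdist x A) \<le> 2"
    by (simp add: infdist_nonneg)
  then have "(1/2)^n * max 0 (2 - dist x (a n) / infdist x A) \<le> (1/2)^n * 2"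
    by (intro mult_left_mono) auto
  then show ?thesis
    by (simp add: extension_weight_def mult.commute)
qed

lemma summable_bound: "summable (\<lambda>n. 2 * (1/2)^n :: real)"
  by (intro summable_mult summable_geometric) auto

lemma summable_weight: "summable (w x)"
  by (rule summable_comparison_test'[OF summable_bound])
     (use weight_bound weight_nonneg in auto)

lemma weight_nonzero_iff:
  assumes "x \<notin> A"
  shows "w x n \<noteq> 0 \<longleftrightarrow> dist x (a n) < 2 * infdist x A"
  using infdist_pos[OF assms] by (auto simp: extension_weight_def max_def field_simps)

lemma suminf_weight_pos:
  assumes "x \<notin> A"
  shows "0 < suminf (w x)"
proof -
  have pos: "0 < infdist x A"
    by (rule infdist_pos[OF assms])
  obtain y where y: "y \<in> A" "dist x y < 2 * infdist x A"
  proof -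
    have "2 * infdist x A \<le> infdist x A" if "\<And>y. y \<in> A \<Longrightarrow> 2 * infdist x A \<le> dist x y"
      unfolding infdist_notempty[OF A_nonempty, of x]
      by (rule cINF_greatest[OF A_nonempty]) (use that infdist_notempty[OF A_nonempty, of x] in simp)
    then show thesis
      using that pos by force
  qed
  obtain n where n: "dist (a n) y < 2 * infdist x A - dist x y"
    using dense[OF y(1), of "2 * infdist x A - dist x y"] y(2) by auto
  have "dist x (a n) \<le> dist x y + dist (a n) y"
    by (metis dist_triangle dist_commute)
  then have "w x n \<noteq> 0"
    unfolding weight_nonzero_iff[OF assms] using n by linarith
  then show ?thesis
    using suminf_pos2[OF summable_weight weight_nonneg, of x n] weight_nonneg[of x n] by linarith
qed

lemmas mean_near = weighted_mean_near[OF summable_weight weight_nonneg suminf_weight_pos]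

lemma extend_from_in [simp]: "x \<in> A \<Longrightarrow> extend_from A a f x = f x"
  by (simp add: extend_from_def)

lemma extend_from_bound:
  assumes "\<And>y. y \<in> A \<Longrightarrow> \<bar>f y\<bar> \<le> M"
  shows "\<bar>extend_from A a f x\<bar> \<le> M"
proof (cases "x \<in> A")
  case False
  with mean_near(2)[OF False, of "\<lambda>n. f (a n)" 0 M] show ?thesis
    using assms in_A by (simp add: extend_from_def)
qed (use assms in simp)

lemma summable_extend:
  assumes "\<And>y. y \<in> A \<Longrightarrow> \<bar>f y\<bar> \<le> M" "x \<notin> A"
  shows "summable (\<lambda>n. w x n * f (a n))"
  using mean_near(1)[OF assms(2), of "\<lambda>n. f (a n)" 0 M] assms(1) in_A by simp

lemma extend_from_linear:
  assumes "\<And>y. y \<in> A \<Longrightarrow> \<bar>f y\<bar> \<le> M" "\<And>y. y \<in> A \<Longrightarrow> \<bar>g y\<bar> \<le> N"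
  shows "extend_from A a (\<lambda>y. f y + g y) x = extend_from A a f x + extend_from A a g x"
    and "extend_from A a (\<lambda>y. b * f y) x = b * extend_from A a f x"
proof -
  have "(\<Sum>n. w x n * (f (a n) + g (a n))) = (\<Sum>n. w x n * f (a n)) + (\<Sum>n. w x n * g (a n))"
    if "x \<notin> A"
    using suminf_add[OF summable_extend[of f M, OF assms(1) that] summable_extend[of g N, OF assms(2) that]]
    by (simp add: distrib_left)
  then show "extend_from A a (\<lambda>y. f y + g y) x = extend_from A a f x + extend_from A a g x"
    by (auto simp: extend_from_def add_divide_distrib)
  have "(\<Sum>n. w x n * (b * f (a n))) = b * (\<Sum>n. w x n * f (a n))" if "x \<notin> A"
    using suminf_mult[OF summable_extend[of f M, OF assms(1) that], of b] by (simp add: algebra_simps)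
  then show "extend_from A a (\<lambda>y. b * f y) x = b * extend_from A a f x"
    by (auto simp: extend_from_def)
qed

lemma continuous_on_weighted_sum:
  assumes c: "\<And>n. \<bar>c n\<bar> \<le> M"
  shows "continuous_on (- A) (\<lambda>x. \<Sum>n. w x n * c n)"
proof (rule uniform_limit_theorem)
  have "norm (w x n * c n) \<le> 2 * (1/2)^n * M" for x n
    using mult_mono[OF weight_bound[of x n] c[of n]] weight_nonneg[of x n] by (simp add: abs_mult)
  then show "uniform_limit (- A) (\<lambda>n x. \<Sum>i<n. w x i * c i) (\<lambda>x. \<Sum>i. w x i * c i) sequentially"
    by (intro Weierstrass_m_test[where M = "\<lambda>n. 2 * (1/2)^n * M"] summable_mult2 summable_bound)
  have "continuous_on (- A) (\<lambda>x. w x n)" for n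
    unfolding extension_weight_def using infdist_pos by (intro continuous_intros) force
  then show "\<forall>\<^sub>F n in sequentially. continuous_on (- A) (\<lambda>x. \<Sum>i<n. w x i * c i)"
    by (intro always_eventually allI continuous_intros)
qed simp

text \<open>
  For \<open>x\<close> in \<open>A\<close> and \<open>y\<close> outside \<open>A\<close>, each \<open>a n\<close> that has positive weight at \<open>y\<close> satisfies
  \<open>dist (a n) x \<le> dist (a n) y + dist y x < 2 * infdist y A + dist y x \<le> 3 * dist y x\<close>, which explains
  the radius \<open>d/3\<close> below; the extended value at \<open>y\<close> is then a mean of values close to \<open>f x\<close>.
\<close>

lemma continuous_extend_from:
  assumes f: "continuous_on A f" and M: "\<And>y. y \<in> A \<Longrightarrow> \<bar>f y\<bar> \<le> M"
  shows "continuous_on UNIV (extend_from A a f)"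
proof -
  have outside: "continuous_on (- A) (extend_from A a f)"
  proof -
    have "continuous_on (- A)
      (\<lambda>x. (\<Sum>n. w x n * f (a n)) / (\<Sum>n. w x n * 1))"
      using suminf_weight_pos
      by (intro continuous_on_divide continuous_on_weighted_sum[where M = M]
                continuous_on_weighted_sum[where M = 1]) (auto simp: M in_A less_imp_neq[symmetric])
    then show ?thesis
      by (rule continuous_on_eq) (simp add: extend_from_def)
  qed
  have "isCont (extend_from A a f) x" for x
  proof (cases "x \<in> A")
    case False
    then show ?thesis
      using outside closed continuous_on_eq_continuous_at[of "- A"] by (auto simp: open_Compl)
  next
    case True
    show ?thesis
      unfolding continuous_at_eps_delta
    proof (intro allI impI)
      fix e :: real assume "0 < e"
      then obtain d where d: "0 < d" "\<And>y. y \<in> A \<Longrightarrow> dist y x < d \<Longrightarrow> dist (f y) (f x) < e/2"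
        using f True unfolding continuous_on_iff by (metis half_gt_zero)
      have "dist (extend_from A a f y) (extend_from A a f x) < e" if y: "dist y x < d/3" for y
      proof (cases "y \<in> A")
        case True
        have "dist y x < d"
          using y d(1) by linarith
        then show ?thesis
          using d(2)[OF True] \<open>0 < e\<close> \<open>x \<in> A\<close> True by simp
      next
        case False
        have near: "\<bar>f (a n) - f x\<bar> \<le> e/2" if "w y n \<noteq> 0" for n
        proof -
          have "dist y (a n) < 2 * infdist y A"
            using that weight_nonzero_iff[OF False] by simp
          moreover have "infdist y A \<le> dist y x"
            using \<open>x \<in> A\<close> by (rule infdist_le)
          moreover have "dist (a n) x \<le> dist y (a n) + dist y x"
            by (metis dist_triangle dist_commute)
          ultimately have "dist (a n) x < d"
            using y by linarith
          then show ?thesis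
            using d(2)[OF in_A] by (simp add: dist_real_def less_imp_le)
        qed
        have "\<bar>(\<Sum>n. w y n * f (a n)) / suminf (w y) - f x\<bar> \<le> e/2"
          by (rule mean_near(2)[OF False near])
        then show ?thesis
          using False \<open>x \<in> A\<close> \<open>0 < e\<close> by (simp add: extend_from_def dist_real_def)
      qed
      then show "\<exists>d>0. \<forall>y. dist y x < d \<longrightarrow>
          dist (extend_from A a f y) (extend_from A a f x) < e"
        using d(1) by (intro exI[of _ "d/3"]) auto
    qed
  qed
  then show ?thesis
    by (simp add: continuous_on_eq_continuous_at)
qed

end

text \<open>
  Composition with \<open>\<phi>\<close> preserves the norm because \<open>\<phi>\<close> is onto; the extension does not increase it,
  and does not decrease it because it restricts to the given function on \<open>A\<close>.
\<close>

lemma linear_isometry_of_continuous_surjection: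
  fixes \<phi> :: "'s::metric_space \<Rightarrow> 'r::metric_space"
  assumes A: "compact A" and \<phi>: "continuous_on A \<phi>" "\<phi> ` A = UNIV"
  shows "\<exists>T :: ('r \<Rightarrow>\<^sub>C real) \<Rightarrow> ('s \<Rightarrow>\<^sub>C real). linear T \<and> (\<forall>f. norm (T f) = norm f)"
proof -
  have "A \<noteq> {}"
    using \<phi>(2) by auto
  from compact_dense_sequence[OF A this]
  obtain a :: "nat \<Rightarrow> 's" where a: "range a \<subseteq> A" "\<forall>y\<in>A. \<forall>e>0. \<exists>n. dist (a n) y < e"
    by (elim exE conjE)
  interpret dense_sequence A a
  proof
    show "closed A"
      by (rule compact_imp_closed[OF A])
    show "a n \<in> A" for n
      using a(1) by (simp add: image_subset_iff)
  qed (use a(2) in blast)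
  define E :: "('r \<Rightarrow>\<^sub>C real) \<Rightarrow> 's \<Rightarrow> real" where "E f = extend_from A a (\<lambda>s. f (\<phi> s))" for f
  have bd: "\<bar>f (\<phi> s)\<bar> \<le> norm f" for f :: "'r \<Rightarrow>\<^sub>C real" and s
    using norm_bounded[of f "\<phi> s"] by simp
  have E_bound: "\<bar>E f s\<bar> \<le> norm f" for f s
    unfolding E_def by (rule extend_from_bound) (rule bd)
  have "continuous_on A (\<lambda>s. f (\<phi> s))" for f :: "'r \<Rightarrow>\<^sub>C real"
    by (rule continuous_on_compose2[OF _ \<phi>(1)]) auto
  then have "continuous_on UNIV (E f)" for f
    unfolding E_def by (rule continuous_extend_from) (rule bd)
  then have "E f \<in> bcontfun" for f
    by (rule bcontfun_normI[where b = "norm f"]) (simp only: real_norm_def E_bound)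
  then have T: "apply_bcontfun (Bcontfun (E f)) = E f" for f
    by (simp add: Bcontfun_inverse)
  have E_add: "E (f + g) s = E f s + E g s" for f g s
    unfolding E_def plus_bcontfun.rep_eq by (rule extend_from_linear(1)[OF bd bd])
  have E_scale: "E (b *\<^sub>R f) s = b *\<^sub>R E f s" for b f s
    unfolding E_def scaleR_bcontfun.rep_eq real_scaleR_def
    by (rule extend_from_linear(2)[OF bd bd])
  have "linear (\<lambda>f. Bcontfun (E f))"
    by (rule linearI; rule bcontfun_eqI)
       (simp_all only: T plus_bcontfun.rep_eq scaleR_bcontfun.rep_eq E_add E_scale)
  moreover have "norm (Bcontfun (E f)) = norm f" for f
  proof (rule antisym)
    show "norm (Bcontfun (E f)) \<le> norm f"
      by (rule norm_bound) (simp only: T real_norm_def E_bound)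
    show "norm f \<le> norm (Bcontfun (E f))"
    proof (rule norm_bound)
      fix r
      obtain s where "s \<in> A" "r = \<phi> s"
        using \<phi>(2) by blast
      then show "norm (f r) \<le> norm (Bcontfun (E f))"
        using norm_bounded[of "Bcontfun (E f)" s] unfolding T by (simp add: E_def)
    qed
  qed
  ultimately show ?thesis
    by blast
qed

section \<open>Closed relations between compact spaces\<close>

text \<open>
  This is the closed graph theorem for a compact range: the preimage of a closed set \<open>U\<close> is the
  first projection of the part of \<open>G\<close> that lies over \<open>U\<close>, hence compact.
\<close>

lemma continuous_surjection_of_closed_relation:
  fixes G :: "('s::metric_space \<times> 'r::metric_space) set"
  assumes compact: "compact (UNIV :: 's set)" "compact (UNIV :: 'r set)"
    and G: "closed G" "snd ` G = UNIV" "\<And>s r r'. (s, r) \<in> G \<Longrightarrow> (s, r') \<in> G \<Longrightarrow> r = r'"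
  obtains A and \<phi> :: "'s \<Rightarrow> 'r" where "compact A" "continuous_on A \<phi>" "\<phi> ` A = UNIV"
proof -
  have image_compact: "compact (fst ` (G \<inter> (UNIV \<times> U)))" if "closed U" for U
  proof (rule compact_continuous_image)
    have "compact ((UNIV \<times> UNIV) \<inter> (G \<inter> (UNIV \<times> U)))"
      by (rule compact_Int_closed[OF compact_Times[OF compact] closed_Int[OF G(1) closed_Times[OF closed_UNIV that]]])
    then show "compact (G \<inter> (UNIV \<times> U))"
      by simp
  qed (intro continuous_intros)
  define \<phi> where "\<phi> s = (THE r. (s, r) \<in> G)" for s
  have \<phi>: "\<phi> s = r" if "(s, r) \<in> G" for s r
    unfolding \<phi>_def by (rule the_equality) (fact that, erule G(3), fact that)
  have "continuous_on (fst ` G) \<phi>"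
    unfolding continuous_on_closed_invariant
  proof (intro allI impI)
    fix U :: "'r set" assume "closed U"
    have "fst ` (G \<inter> (UNIV \<times> U)) \<inter> fst ` G = \<phi> -` U \<inter> fst ` G"
    proof (intro set_eqI iffI)
      fix s assume "s \<in> fst ` (G \<inter> (UNIV \<times> U)) \<inter> fst ` G"
      then obtain r where "(s, r) \<in> G" "r \<in> U"
        by auto
      then show "s \<in> \<phi> -` U \<inter> fst ` G"
        using \<phi>[of s r] by (auto intro: image_eqI[of _ fst "(s, r)"])
    next
      fix s assume "s \<in> \<phi> -` U \<inter> fst ` G"
      then obtain r where "(s, r) \<in> G" "\<phi> s \<in> U"
        by auto
      then show "s \<in> fst ` (G \<inter> (UNIV \<times> U)) \<inter> fst ` G"
        using \<phi>[of s r] by (auto intro!: image_eqI[of _ fst "(s, r)"])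
    qed
    then show "\<exists>V. closed V \<and> V \<inter> fst ` G = \<phi> -` U \<inter> fst ` G"
      using compact_imp_closed[OF image_compact[OF \<open>closed U\<close>]] by blast
  qed
  moreover have "compact (fst ` G)"
    using image_compact[of UNIV] by simp
  moreover have "\<phi> ` fst ` G = UNIV"
  proof -
    have "r \<in> \<phi> ` fst ` G" for r
    proof -
      have "r \<in> snd ` G"
        unfolding G(2) by (rule UNIV_I)
      then obtain s where "(s, r) \<in> G"
        by auto
      then show ?thesis
        using \<phi>[of s r] by (metis fst_conv image_eqI)
    qed
    then show ?thesis
      by (rule UNIV_eq_I[symmetric])
  qed
  ultimately show thesis
    by (intro that)
qed

section \<open>From a non-linear embedding to a surjection between the compact spaces\<close>

text \<open>
  The inequality is linear in \<open>h r\<close> and \<open>k r\<close> instead of being restricted to functions with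
  \<open>h r = 1/2\<close> and \<open>k r = - 1/2\<close>, which is where it is applied.  In this form it is visibly closed in
  \<open>(s, r)\<close>, as the quantified functions do not depend on \<open>r\<close>.
\<close>

definition peak_relation ::
  "(('r::metric_space \<Rightarrow>\<^sub>C real) \<Rightarrow> ('s::metric_space \<Rightarrow>\<^sub>C real)) \<Rightarrow> real \<Rightarrow> real \<Rightarrow> ('s \<times> 'r) set"
where
  "peak_relation F c \<sigma> =
     {(s, r). \<forall>h k. norm h \<le> 1/2 \<longrightarrow> norm k \<le> 1/2 \<longrightarrow>
        2 * c - 2 + apply_bcontfun h r - apply_bcontfun k r
          \<le> \<sigma> * (apply_bcontfun (F h) s - apply_bcontfun (F k) s)}"

lemma closed_peak_relation: "closed (peak_relation F c \<sigma>)"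
proof -
  have cont: "continuous_on UNIV (\<lambda>z. f (fst z))" "continuous_on UNIV (\<lambda>z. g (snd z))"
    for f :: "'a::metric_space \<Rightarrow>\<^sub>C real" and g :: "'b::metric_space \<Rightarrow>\<^sub>C real"
    by (rule continuous_on_compose2[OF continuous_on_apply_bcontfun]; auto intro: continuous_intros)+
  show ?thesis
    unfolding peak_relation_def case_prod_unfold
    by (intro closed_Collect_all closed_Collect_imp open_Collect_const closed_Collect_le
        continuous_intros cont)
qed

lemma norm_attained:
  fixes f :: "'s::metric_space \<Rightarrow>\<^sub>C real"
  assumes "compact (UNIV :: 's set)"
  obtains s where "\<bar>f s\<bar> = norm f"
proof -
  have "continuous_on UNIV (\<lambda>s. \<bar>f s\<bar>)"
    by (intro continuous_intros) simp
  with continuous_attains_sup[OF assms] obtain s where "\<And>t. \<bar>f t\<bar> \<le> \<bar>f s\<bar>"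
    by auto
  then show thesis
    using that[of s] norm_bound[of f "\<bar>f s\<bar>"] norm_bounded[of f s] by auto
qed

lemma bump_function:
  fixes r :: "'r::metric_space"
  assumes "0 < d"
  obtains f :: "'r \<Rightarrow>\<^sub>C real" where "f r = 1" "norm f \<le> 1" "\<And>x. 0 \<le> f x" "\<And>x. d \<le> dist x r \<Longrightarrow> f x = 0"
proof -
  let ?f = "\<lambda>x. max 0 (1 - dist x r / d)"
  have le: "norm (?f x) \<le> 1" for x
    using assms by simp
  have "?f \<in> bcontfun"
    by (rule bcontfun_normI[OF _ le]) (use assms in \<open>intro continuous_intros; simp\<close>)
  then have app: "apply_bcontfun (Bcontfun ?f) = ?f"
    by (rule Bcontfun_inverse)
  show thesis
    by (rule that[of "Bcontfun ?f"]; (rule norm_bound)?; (unfold app)?)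
       (use assms le in \<open>auto simp: field_simps max_def\<close>)
qed

text \<open>
  Away from \<open>r\<close> the bump vanishes, and the distance is at most \<open>1/2 \<le> 1 - h r\<close>.  Near \<open>r\<close>, where
  \<open>0 \<le> f x \<le> 1\<close> and \<open>h x\<close> is almost \<open>h r\<close>, the distance is at most the larger of \<open>1 - h x\<close> and
  \<open>h x \<le> 1/2\<close>.
\<close>

lemma half_norm_bump_distance:
  fixes h f :: "'r::metric_space \<Rightarrow>\<^sub>C real"
  assumes h: "norm h \<le> 1/2" and near: "\<And>x. dist x r < d \<Longrightarrow> \<bar>h x - h r\<bar> \<le> e"
    and f: "norm f \<le> 1" "\<And>x. 0 \<le> f x" "\<And>x. d \<le> dist x r \<Longrightarrow> f x = 0" and "0 \<le> e"
  shows "norm (h - f) \<le> 1 - h r + e"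
proof (rule norm_bound)
  fix x
  have hb: "\<bar>h y\<bar> \<le> 1/2" for y
    using norm_bounded[of h y] h by simp
  have "f x \<le> 1"
    using norm_bounded[of f x] f(1) by simp
  have "\<bar>h x - f x\<bar> \<le> 1 - h r + e"
  proof (cases "dist x r < d")
    case True
    then show ?thesis
      using hb[of x] hb[of r] near[of x] f(2)[of x] \<open>f x \<le> 1\<close> \<open>0 \<le> e\<close>
      unfolding abs_le_iff by linarith
  next
    case False
    then show ?thesis
      using hb[of x] hb[of r] f(3)[of x] \<open>0 \<le> e\<close> unfolding abs_le_iff by simp
  qed
  then show "norm ((h - f) x) \<le> 1 - h r + e"
    by simp
qed

text \<open>
  For bumps \<open>f n\<close> supported in shrinking balls around \<open>r\<close>, let \<open>s n\<close> be a point where \<open>F (f n)\<close> and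
  \<open>F (- f n)\<close> differ by at least \<open>2 * c\<close>, and let \<open>\<sigma> n\<close> be the sign of the difference.  A limit point of the pairs
  \<open>(s n, \<sigma> n)\<close> does what is required: \<open>F h\<close> and \<open>F k\<close> differ from \<open>F (f n)\<close> and \<open>F (- f n)\<close> by at most
  about \<open>1 - h r\<close> and \<open>1 + k r\<close>, which leaves \<open>2 * c - (1 - h r) - (1 + k r)\<close> of the oscillation.
\<close>

lemma peak_relation_total:
  fixes F :: "('r::metric_space \<Rightarrow>\<^sub>C real) \<Rightarrow> ('s::metric_space \<Rightarrow>\<^sub>C real)"
  assumes S: "compact (UNIV :: 's set)"
    and lower: "\<And>f g. norm f \<le> 1 \<Longrightarrow> norm g \<le> 1 \<Longrightarrow> c * norm (f - g) \<le> norm (F f - F g)"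
    and upper: "\<And>f g. norm f \<le> 1 \<Longrightarrow> norm g \<le> 1 \<Longrightarrow> norm (F f - F g) \<le> norm (f - g)"
    and "0 \<le> c"
  shows "\<exists>\<sigma>\<in>{1, -1}. \<exists>s. (s, r) \<in> peak_relation F c \<sigma>"
proof -
  have "\<exists>f :: 'r \<Rightarrow>\<^sub>C real. apply_bcontfun f r = 1 \<and> norm f \<le> 1 \<and> (\<forall>x. 0 \<le> f x) \<and>
          (\<forall>x. inverse (real (Suc n)) \<le> dist x r \<longrightarrow> f x = 0)" for n
    by (rule bump_function[of "inverse (real (Suc n))" r]) auto
  then obtain f :: "nat \<Rightarrow> 'r \<Rightarrow>\<^sub>C real" where
    f: "\<And>n. f n r = 1" "\<And>n. norm (f n) \<le> 1" "\<And>n x. 0 \<le> f n x"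
       "\<And>n x. inverse (real (Suc n)) \<le> dist x r \<Longrightarrow> f n x = 0"
    by metis
  have "\<exists>s \<sigma>. \<sigma> \<in> {1, -1} \<and> 2 * c \<le> \<sigma> * (F (f n) s - F (- f n) s)" for n
  proof -
    have "2 \<le> norm (f n - (- f n))"
      using norm_bounded[of "f n - (- f n)" r] f(1)[of n] by simp
    then have "c * 2 \<le> c * norm (f n - (- f n))"
      using \<open>0 \<le> c\<close> by (rule mult_left_mono)
    also have "\<dots> \<le> norm (F (f n) - F (- f n))"
      using f(2)[of n] by (intro lower) auto
    finally have "c * 2 \<le> norm (F (f n) - F (- f n))" .
    moreover obtain s where "\<bar>(F (f n) - F (- f n)) s\<bar> = norm (F (f n) - F (- f n))"
      using norm_attained[OF S] by metis
    ultimately have "2 * c \<le> \<bar>F (f n) s - F (- f n) s\<bar>"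
      by simp
    then show ?thesis
      by (intro exI[of _ s] exI[of _ "if 0 \<le> F (f n) s - F (- f n) s then 1 else - 1"]) auto
  qed
  then obtain s \<sigma> where s: "\<And>n. \<sigma> n \<in> {1, -1::real}"
    "\<And>n. 2 * c \<le> \<sigma> n * (F (f n) (s n) - F (- f n) (s n))"
    by (metis (no_types, lifting))
  \<comment> \<open>Points and signs are made to converge along the same subsequence.\<close>
  have "compact ((UNIV :: 's set) \<times> {1, -1::real})"
    by (intro compact_Times S) auto
  then have "seq_compact ((UNIV :: 's set) \<times> {1, -1::real})"
    by (simp only: compact_eq_seq_compact_metric)
  moreover have "\<forall>n. (s n, \<sigma> n) \<in> UNIV \<times> {1, -1}"
    using s(1) by auto
  ultimately obtain l q where lq: "l \<in> UNIV \<times> {1, -1::real}" "strict_mono q"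
    "((\<lambda>n. (s n, \<sigma> n)) \<circ> q) \<longlonglongrightarrow> l"
    by (rule seq_compactE)
  obtain t \<tau> where l: "l = (t, \<tau>)"
    by (cases l)
  have \<tau>: "\<tau> \<in> {1, -1}"
    using lq(1) l by auto
  have lim: "(\<lambda>n. s (q n)) \<longlonglongrightarrow> t" "(\<lambda>n. \<sigma> (q n)) \<longlonglongrightarrow> \<tau>"
    using tendsto_fst[OF lq(3)] tendsto_snd[OF lq(3)] by (simp_all add: l o_def)
  have "2 * c - 2 + h r - k r \<le> \<tau> * (F h t - F k t)"
    if h: "norm h \<le> 1/2" and k: "norm k \<le> 1/2" for h k :: "'r \<Rightarrow>\<^sub>C real"
  proof (rule field_le_epsilon)
    fix e :: real assume "0 < e"
    have near: "\<exists>d>0. \<forall>x. dist x r < d \<longrightarrow> dist (g x) (g r) < e/2" for g :: "'r \<Rightarrow>\<^sub>C real"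
    proof -
      have "0 < e/2"
        using \<open>0 < e\<close> by simp
      with continuous_on_apply_bcontfun[of UNIV g] show ?thesis
        unfolding continuous_on_iff by (simp only: UNIV_I simp_thms ball_UNIV)
    qed
    obtain d1 where d1: "0 < d1" "\<And>x. dist x r < d1 \<Longrightarrow> dist (h x) (h r) < e/2"
      using near[of h] by blast
    obtain d2 where d2: "0 < d2" "\<And>x. dist x r < d2 \<Longrightarrow> dist (k x) (k r) < e/2"
      using near[of k] by blast
    obtain N where N: "inverse (real (Suc N)) < min d1 d2"
      using reals_Archimedean[of "min d1 d2"] d1(1) d2(1) by auto
    have ev: "2 * c - 2 + h r - k r - e \<le> \<sigma> (q n) * (F h (s (q n)) - F k (s (q n)))" if "N \<le> n" for n
    proof -
      let ?m = "q n"
      have "N \<le> ?m"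
        using that seq_suble[OF lq(2), of n] by simp
      then have "inverse (real (Suc ?m)) \<le> inverse (real (Suc N))"
        by (intro le_imp_inverse_le) auto
      with N have small: "inverse (real (Suc ?m)) < d1" "inverse (real (Suc ?m)) < d2"
        by linarith+
      have "norm (h - f ?m) \<le> 1 - h r + e/2"
      proof (rule half_norm_bump_distance[OF h _ f(2,3)])
        show "\<bar>h x - h r\<bar> \<le> e/2" if "dist x r < inverse (real (Suc ?m))" for x
          using d1(2)[of x] that small by (simp add: dist_real_def)
      qed (use f(4) \<open>0 < e\<close> in auto)
      \<comment> \<open>The estimate for \<open>k\<close> and the negative bump is the one for \<open>- k\<close> and the bump.\<close>
      moreover have "norm (- k - f ?m) \<le> 1 - (- k) r + e/2"
      proof (rule half_norm_bump_distance[OF _ _ f(2,3)])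
        show "\<bar>(- k) x - (- k) r\<bar> \<le> e/2" if "dist x r < inverse (real (Suc ?m))" for x
          using d2(2)[of x] that small by (simp add: dist_real_def abs_minus_commute)
      qed (use f(4) \<open>0 < e\<close> k in auto)
      moreover have "norm (- k - f ?m) = norm (k - (- f ?m))"
        using norm_minus_cancel[of "k + f ?m"] by simp
      ultimately have close: "norm (h - f ?m) \<le> 1 - h r + e/2" "norm (k - (- f ?m)) \<le> 1 + k r + e/2"
        by simp_all
      have "\<bar>F h (s ?m) - F (f ?m) (s ?m)\<bar> \<le> norm (F h - F (f ?m))"
        using norm_bounded[of "F h - F (f ?m)" "s ?m"] by simp
      also have "\<dots> \<le> norm (h - f ?m)"
        using h f(2) by (intro upper) auto
      finally have Fh: "\<bar>F h (s ?m) - F (f ?m) (s ?m)\<bar> \<le> 1 - h r + e/2"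
        using close(1) by (rule order_trans)
      have "\<bar>F k (s ?m) - F (- f ?m) (s ?m)\<bar> \<le> norm (F k - F (- f ?m))"
        using norm_bounded[of "F k - F (- f ?m)" "s ?m"] by simp
      also have "\<dots> \<le> norm (k - (- f ?m))"
        using k f(2) by (intro upper) auto
      finally have Fk: "\<bar>F k (s ?m) - F (- f ?m) (s ?m)\<bar> \<le> 1 + k r + e/2"
        using close(2) by (rule order_trans)
      consider "\<sigma> ?m = 1" | "\<sigma> ?m = - 1"
        using s(1)[of ?m] by blast
      then show ?thesis
        using s(2)[of ?m] Fh Fk unfolding abs_le_iff by cases simp_all
    qed
    have "(\<lambda>n. g (s (q n))) \<longlonglongrightarrow> g t" for g :: "'s \<Rightarrow>\<^sub>C real"
      using continuous_on_tendsto_compose[OF continuous_on_apply_bcontfun[of UNIV g] lim(1)] by simp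
    then have "(\<lambda>n. \<sigma> (q n) * (F h (s (q n)) - F k (s (q n)))) \<longlonglongrightarrow> \<tau> * (F h t - F k t)"
      by (intro tendsto_intros lim(2))
    then have "2 * c - 2 + h r - k r - e \<le> \<tau> * (F h t - F k t)"
      by (rule LIMSEQ_le_const) (use ev in blast)
    then show "2 * c - 2 + h r - k r \<le> \<tau> * (F h t - F k t) + e"
      by simp
  qed
  then have "(t, r) \<in> peak_relation F c \<tau>"
    by (simp add: peak_relation_def)
  then show ?thesis
    using \<tau> by blast
qed

lemma half_norm_separation:
  fixes r r' :: "'r::metric_space"
  assumes "r \<noteq> r'"
  obtains u :: "'r \<Rightarrow>\<^sub>C real" where "norm u \<le> 1/2" "u r = 1/2" "u r' = - (1/2)"
proof -
  let ?f = "\<lambda>x. max (- (1/2)) (1/2 - dist x r / dist r' r)"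
  have le: "norm (?f x) \<le> 1/2" for x
  proof -
    have "0 \<le> dist x r / dist r' r"
      by simp
    then show ?thesis
      unfolding real_norm_def abs_le_iff by linarith
  qed
  have "?f \<in> bcontfun"
    by (rule bcontfun_normI[OF _ le]) (use assms in \<open>intro continuous_intros; simp\<close>)
  then have app: "apply_bcontfun (Bcontfun ?f) = ?f"
    by (rule Bcontfun_inverse)
  show thesis
    by (rule that[of "Bcontfun ?f"]; (rule norm_bound)?; (unfold app)?)
       (use assms le in auto)
qed

text \<open>
  If both signs agree, a function \<open>u\<close> with values \<open>1/2\<close> at \<open>r\<close> and \<open>- 1/2\<close> at \<open>r'\<close> gets contradictory
  signs for \<open>F u s - F (- u) s\<close>; if the signs differ, the constant \<open>1/2\<close> does.
\<close>

lemma peak_relation_functional: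
  fixes F :: "('r::metric_space \<Rightarrow>\<^sub>C real) \<Rightarrow> ('s::metric_space \<Rightarrow>\<^sub>C real)"
  assumes c: "1/2 < c" and \<sigma>: "\<sigma> \<in> {1, -1}" "\<sigma>' \<in> {1, -1}"
    and r: "(s, r) \<in> peak_relation F c \<sigma>" and r': "(s, r') \<in> peak_relation F c \<sigma>'"
  shows "r = r'"
proof (rule ccontr)
  assume "r \<noteq> r'"
  have pos: "0 < \<tau> * (F h s - F (- h) s)"
    if "(s, p) \<in> peak_relation F c \<tau>" "norm h \<le> 1/2" "h p = 1/2"
    for h :: "'r \<Rightarrow>\<^sub>C real" and p \<tau>
  proof -
    have "2 * c - 2 + h p - (- h) p \<le> \<tau> * (F h s - F (- h) s)"
      using that(1,2) unfolding peak_relation_def mem_Collect_eq prod.case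
      by (elim allE[of _ h] allE[of _ "- h"] impE) auto
    then show ?thesis
      using c that(3) by simp
  qed
  show False
  proof (cases "\<sigma> = \<sigma>'")
    case True
    obtain u :: "'r \<Rightarrow>\<^sub>C real" where "norm u \<le> 1/2" "u r = 1/2" "u r' = - (1/2)"
      using half_norm_separation[OF \<open>r \<noteq> r'\<close>] .
    then show False
      using pos[OF r, of u] pos[OF r', of "- u"] \<sigma> True by auto
  next
    case False
    let ?h = "const_bcontfun (1/2) :: 'r \<Rightarrow>\<^sub>C real"
    have "norm ?h \<le> 1/2"
      by (rule norm_bound) (simp add: const_bcontfun.rep_eq)
    then show False
      using pos[OF r, of ?h] pos[OF r', of ?h] \<sigma> False by (auto simp: const_bcontfun.rep_eq)
  qed
qed

text \<open>
  The bound \<open>c > 1/2\<close> is what makes \<open>2 * c - 1\<close> positive, so that a point of \<open>S\<close> cannot serve two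
  points of \<open>R\<close>.
\<close>

theorem linear_isometry_of_ball_embedding:
  fixes F :: "('r::metric_space \<Rightarrow>\<^sub>C real) \<Rightarrow> ('s::metric_space \<Rightarrow>\<^sub>C real)"
  assumes R: "compact (UNIV :: 'r set)" and S: "compact (UNIV :: 's set)" and c: "1/2 < c"
    and lower: "\<And>f g. norm f \<le> 1 \<Longrightarrow> norm g \<le> 1 \<Longrightarrow> c * norm (f - g) \<le> norm (F f - F g)"
    and upper: "\<And>f g. norm f \<le> 1 \<Longrightarrow> norm g \<le> 1 \<Longrightarrow> norm (F f - F g) \<le> norm (f - g)"
  shows "\<exists>T :: ('r \<Rightarrow>\<^sub>C real) \<Rightarrow> ('s \<Rightarrow>\<^sub>C real). linear T \<and> (\<forall>f. norm (T f) = norm f)"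
proof -
  define G where "G = peak_relation F c 1 \<union> peak_relation F c (- 1)"
  have total: "\<exists>\<sigma>\<in>{1, -1}. \<exists>s. (s, r) \<in> peak_relation F c \<sigma>" for r
    using c by (intro peak_relation_total[OF S lower upper]) auto
  have "closed G"
    unfolding G_def by (intro closed_Un closed_peak_relation)
  moreover have "snd ` G = UNIV"
    using total by (force simp: G_def image_iff)
  moreover have "r = r'" if "(s, r) \<in> G" "(s, r') \<in> G" for s r r'
    using that peak_relation_functional[OF c] unfolding G_def by blast
  ultimately obtain A and \<phi> :: "'s \<Rightarrow> 'r"
    where "compact A" "continuous_on A \<phi>" "\<phi> ` A = UNIV"
    using continuous_surjection_of_closed_relation[OF S R] by metis
  then show ?thesis
    by (rule linear_isometry_of_continuous_surjection)
qed

theorem corollary3p4: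
  fixes F :: "('r::metric_space \<Rightarrow>\<^sub>C real) \<Rightarrow> ('s::metric_space \<Rightarrow>\<^sub>C real)"
  assumes "compact (UNIV :: 'r set)"
    and "compact (UNIV :: 's set)"
    and "\<forall>f\<in>cball 0 1. \<forall>g\<in>cball 0 1.
           15/16 * norm (f - g) \<le> norm (F f - F g) \<and> norm (F f - F g) \<le> norm (f - g)"
  shows "\<exists>T :: ('r \<Rightarrow>\<^sub>C real) \<Rightarrow> ('s \<Rightarrow>\<^sub>C real). linear T \<and> (\<forall>f. norm (T f) = norm f)"
proof (rule linear_isometry_of_ball_embedding[OF assms(1,2)])
  show "1/2 < (15/16 :: real)"
    by simp
  fix f g :: "'r \<Rightarrow>\<^sub>C real"
  assume "norm f \<le> 1" "norm g \<le> 1"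
  then have "f \<in> cball 0 1" "g \<in> cball 0 1"
    by (simp_all only: mem_cball_0)
  with assms(3) show "15/16 * norm (f - g) \<le> norm (F f - F g)" "norm (F f - F g) \<le> norm (f - g)"
    by blast+
qed

end
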